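(* Let $G,J,K,L,M,N,P,Q,R,S$ be complex numbers and put $$\begin{aligned} A&=-G-J-M+2N-P-Q-3S+6,\\ B&=-2G-K-2M-2N-5P-2Q-6R-12S+30,\\ E&=G+J+M-N+2P+2Q+3R+6S-15,\\ F&=-3G-J-3K-7M-12P-3Q-6R-27S+60,\\ H&=-L-2N-P-Q-4R-3S+10,\\ I&=-G-J-2L-M-2P-3Q-6R-7S+20, \end{aligned}$$ and assume $B\ne0$. Then for every integer $n\ge0$, $$\begin{aligned} B\,t_n^{2}&=\sum_{k_1+\cdots+k_5=n}\binom{n}{k_1,\dots,k_5}T_{k_1}\cdots T_{k_5}\\ &\quad-\frac{A}{563^2}5^nX_n-\frac{E}{563^2}\sum_{k=0}^n\binom nk4^{n-k}W_{n-k}T_k+\frac{F}{563}\sum_{k=0}^n\binom nkT_k\\ &\quad-G\sum_{k=0}^n\binom nkt_k^{1}T_{n-k}-\frac{H}{563^2}\sum_{k=0}^n\binom nk3^{n-k}2^kV_{n-k}U_k-\frac{I}{563}\sum_{k=0}^n\binom nk3^kV_kt_{n-k}\\ &\quad+\frac{J}{563^2}\sum_{k_1+k_2+k_3=n}\binom{n}{k_1,k_2,k_3}(-1)^{k_1}2^{k_2}Y_{k_1}U_{k_2}\\ &\quad+\frac{K}{563}\sum_{k_1+k_2+k_3=n}\binom{n}{k_1,k_2,k_3}(-1)^{k_1}Y_{k_1}t_{k_2}\\ &\quad-\frac{L}{563}\sum_{k_1+k_2+k_3=n}\binom{n}{k_1,k_2,k_3}3^{k_1}V_{k_1}T_{k_2}T_{k_3}\\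 &\quad+\frac{M}{563}\sum_{k_1+k_2+k_3+k_4=n}\binom{n}{k_1,k_2,k_3,k_4}(-1)^{k_1}Y_{k_1}T_{k_2}T_{k_3}\\ &\quad-\frac{N}{563^2}\sum_{k_1+k_2+k_3=n}\binom{n}{k_1,k_2,k_3}2^{k_1}U_{k_1}2^{k_2}U_{k_2}T_{k_3}\\ &\quad-P\sum_{k_1+k_2+k_3=n}\binom{n}{k_1,k_2,k_3}t_{k_1}t_{k_2}T_{k_3}\\ &\quad-\frac{Q}{563}\sum_{k_1+k_2+k_3=n}\binom{n}{k_1,k_2,k_3}2^{k_1}U_{k_1}t_{k_2}T_{k_3}\\ &\quad-\frac{R}{563}\sum_{k_1+k_2+k_3+k_4=n}\binom{n}{k_1,k_2,k_3,k_4}2^{k_1}U_{k_1}T_{k_2}T_{k_3}T_{k_4}\\ &\quad-S\sum_{k_1+k_2+k_3+k_4=n}\binom{n}{k_1,k_2,k_3,k_4}t_{k_1}T_{k_2}T_{k_3}T_{k_4}. \end{aligned}$$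
   Context: For given $s_0,s_1,s_2,s_3$, the sequence $T_n^{(s_0,s_1,s_2,s_3)}$ is defined by $T_j^{(s_0,s_1,s_2,s_3)}=s_j$ for $0\le j\le 3$ and, for $n\ge4$, each term being the sum of the four preceding terms. The Tetranacci numbers are $T_n=T_n^{(0,1,1,2)}$. Abbreviate $U_n=T_n^{(40,64,215,344)}$, $V_n=T_n^{(15,27,48,107)}$, $W_n=T_n^{(3052,4658,8804,16451)}$, $X_n=T_n^{(500,1423,2598,4986)}$, $Y_n=T_n^{(-5,2,13,32)}$, and $$t_n=\frac12\left(\sum_{k=0}^n\binom nkT_kT_{n-k}-\frac{2^n}{563}U_n\right).$$ All indices $k_i$ in sums run over nonnegative integers and $\binom{n}{k_1,\dots,k_r}=\frac{n!}{k_1!\cdots k_r!}$. Let $\lambda_1,\lambda_2,\lambda_3,\lambda_4$ be the (distinct, complex) roots of $x^4-x^3-x^2-x-1=0$ and $c_i=\frac1{-\lambda_i^3+6\lambda_i-1}$ (so $\sum_{n\ge0}T_n\frac{x^n}{n!}=\sum_{i=1}^4c_ie^{\lambda_ix}$). The numbers $t_n^1$, $t_n^2$ (superscripts are indices, not powers) are defined by $$\sum_{n=0}^\infty t_n^{1}\frac{x^n}{n!}=\sum_{1\le i<j<l\le4}c_ic_jc_le^{(\lambda_i+\lambda_j+\lambda_l)x}\left(c_ie^{\lambda_ix}+c_je^{\lambda_jx}+c_le^{\lambda_lx}\right),$$ $$\sum_{n=0}^\infty t_n^{2}\frac{x^n}{n!}=\sum_{1\le i<j<l\le4}c_ic_jc_le^{(\lambda_i+\lambda_j+\lambda_l)x}\left(c_ic_je^{(\lambda_i+\lambda_j)x}+c_jc_le^{(\lambda_j+\lambda_l)x}+c_lc_ie^{(\lambda_l+\lambda_i)x}\right).$$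 *)

theory Defs
  imports "HOL-Computational_Algebra.Computational_Algebra"
begin

fun tetra :: "complex \<Rightarrow> complex \<Rightarrow> complex \<Rightarrow> complex \<Rightarrow> nat \<Rightarrow> complex" where
  "tetra s0 s1 s2 s3 0 = s0"
| "tetra s0 s1 s2 s3 (Suc 0) = s1"
| "tetra s0 s1 s2 s3 (Suc (Suc 0)) = s2"
| "tetra s0 s1 s2 s3 (Suc (Suc (Suc 0))) = s3"
| "tetra s0 s1 s2 s3 (Suc (Suc (Suc (Suc n)))) =
     tetra s0 s1 s2 s3 (Suc (Suc (Suc n))) + tetra s0 s1 s2 s3 (Suc (Suc n))
     + tetra s0 s1 s2 s3 (Suc n) + tetra s0 s1 s2 s3 n"

definition Tet :: "nat \<Rightarrow> complex" where "Tet = tetra 0 1 1 2"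
definition Useq :: "nat \<Rightarrow> complex" where "Useq = tetra 40 64 215 344"
definition Vseq :: "nat \<Rightarrow> complex" where "Vseq = tetra 15 27 48 107"
definition Wseq :: "nat \<Rightarrow> complex" where "Wseq = tetra 3052 4658 8804 16451"
definition Xseq :: "nat \<Rightarrow> complex" where "Xseq = tetra 500 1423 2598 4986"
definition Yseq :: "nat \<Rightarrow> complex" where "Yseq = tetra (-5) 2 13 32"

definition tseq :: "nat \<Rightarrow> complex" where
  "tseq n = ((\<Sum>k\<le>n. of_nat (n choose k) * Tet k * Tet (n - k)) - 2 ^ n / 563 * Useq n) / 2"

definition multinom :: "nat \<Rightarrow> nat list \<Rightarrow> complex" where
  "multinom n ks = fact n / (\<Prod>k\<leftarrow>ks. fact k)"

definition tet_roots :: "complex set" where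
  "tet_roots = {z. z ^ 4 - z ^ 3 - z ^ 2 - z - 1 = 0}"

definition tet_coeff :: "complex \<Rightarrow> complex" where
  "tet_coeff z = 1 / (- (z ^ 3) + 6 * z - 1)"

definition triples :: "(nat \<times> nat \<times> nat) set" where
  "triples = {(i, j, l). 1 \<le> i \<and> i < j \<and> j < l \<and> l \<le> 4}"

text \<open>
  The sequences \<open>t\<^sup>1\<close> and \<open>t\<^sup>2\<close> are given by their exponential generating functions,
  read as formal power series; \<open>lam 1, \<dots>, lam 4\<close> is meant to enumerate \<^const>\<open>tet_roots\<close>.
  Hence the \<open>n\<close>-th term is \<open>n!\<close> times the \<open>n\<close>-th coefficient.
\<close>

definition egf1 :: "(nat \<Rightarrow> complex) \<Rightarrow> complex fps" where
  "egf1 lam = (let c = (\<lambda>i. tet_coeff (lam i)) in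
     \<Sum>(i, j, l)\<in>triples.
       fps_const (c i * c j * c l) * fps_exp (lam i + lam j + lam l)
       * (fps_const (c i) * fps_exp (lam i) + fps_const (c j) * fps_exp (lam j)
          + fps_const (c l) * fps_exp (lam l)))"

definition egf2 :: "(nat \<Rightarrow> complex) \<Rightarrow> complex fps" where
  "egf2 lam = (let c = (\<lambda>i. tet_coeff (lam i)) in
     \<Sum>(i, j, l)\<in>triples.
       fps_const (c i * c j * c l) * fps_exp (lam i + lam j + lam l)
       * (fps_const (c i * c j) * fps_exp (lam i + lam j)
          + fps_const (c j * c l) * fps_exp (lam j + lam l)
          + fps_const (c l * c i) * fps_exp (lam l + lam i)))"

definition t1seq :: "(nat \<Rightarrow> complex) \<Rightarrow> nat \<Rightarrow> complex" where
  "t1seq lam n = fact n * fps_nth (egf1 lam) n"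

definition t2seq :: "(nat \<Rightarrow> complex) \<Rightarrow> nat \<Rightarrow> complex" where
  "t2seq lam n = fact n * fps_nth (egf2 lam) n"

text \<open>
  The polynomial is separable, so that its roots can be enumerated bijectively by
  \<open>{1..4}\<close>.
\<close>

lemma tet_roots_simple:
  assumes "z ^ 4 - z ^ 3 - z ^ 2 - z - 1 = (0::complex)"
  shows "4 * z ^ 3 - 3 * z ^ 2 - 2 * z - 1 \<noteq> 0"
proof
  assume d: "4 * z ^ 3 - 3 * z ^ 2 - 2 * z - 1 = 0"
  have "(- 573 + 396 * z - 64 * z ^ 2) * (z ^ 4 - z ^ 3 - z ^ 2 - z - 1)
      + (10 + 157 * z - 103 * z ^ 2 + 16 * z ^ 3) * (4 * z ^ 3 - 3 * z ^ 2 - 2 * z - 1) = 563"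
    by (simp add: algebra_simps eval_nat_numeral)
  with assms d show False by simp
qed

lemma card_tet_roots: "card tet_roots = 4"
proof -
  define p :: "complex poly" where "p = [:-1, -1, -1, -1, 1:]"
  have p: "poly p z = z ^ 4 - z ^ 3 - z ^ 2 - z - 1" for z
    by (simp add: p_def algebra_simps power2_eq_square power3_eq_cube power4_eq_xxxx)
  have dp: "poly (pderiv p) z = 4 * z ^ 3 - 3 * z ^ 2 - 2 * z - 1" for z
    by (simp add: p_def pderiv_pCons algebra_simps power2_eq_square power3_eq_cube)
  have "rsquarefree p"
    unfolding rsquarefree_roots p dp using tet_roots_simple by blast
  then have dec: "smult (lead_coeff p) (\<Prod>z | poly p z = 0. [:- z, 1:]) = p"
    by (rule complex_poly_decompose_rsquarefree)
  have "lead_coeff p = 1" and deg: "degree p = 4"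
    by (simp_all add: p_def)
  with dec have "degree (\<Prod>z | poly p z = 0. [:- z, 1:]) = 4"
    by simp
  moreover have "degree (\<Prod>z | poly p z = 0. [:- z, 1:]) = card {z. poly p z = 0}"
    by (subst degree_prod_eq_sum_degree) auto
  ultimately show ?thesis
    by (simp add: tet_roots_def p)
qed

lemma ex_tet_roots_enum: "\<exists>lam. bij_betw lam {1..4::nat} tet_roots"
  by (rule finite_same_card_bij)
    (use card_tet_roots in \<open>auto intro: card_ge_0_finite\<close>)

end

theory Submission
  imports Defs
begin

text \<open>
  Attach to each root \<open>\<lambda>\<^sub>i\<close> the formal exponential \<open>z\<^sub>i = c\<^sub>i exp (\<lambda>\<^sub>i x)\<close>.  Every sequence in
  the identity then has an exponential generating function that is a symmetric function of
  \<open>z\<^sub>1, \<dots>, z\<^sub>4\<close>.  With \<open>p\<^sub>k\<close> for the power sums and \<open>e\<^sub>k\<close> for the elementary symmetric functions: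

    \<^item> the coefficient sequences of \<open>p\<^sub>1, \<dots>, p\<^sub>5\<close> are \<open>T\<^sub>n\<close>, \<open>2\<^sup>n U\<^sub>n / 563\<close>, \<open>3\<^sup>n V\<^sub>n / 563\<close>,
      \<open>4\<^sup>n W\<^sub>n / 563\<^sup>2\<close> and \<open>5\<^sup>n X\<^sub>n / 563\<^sup>2\<close>;

    \<^item> \<open>t\<close> belongs to \<open>e\<^sub>2 = (p\<^sub>1\<^sup>2 - p\<^sub>2) / 2\<close>, and \<open>t\<^sup>1\<close>, \<open>t\<^sup>2\<close> belong to the monomial symmetric
      functions of types \<open>(2,1,1)\<close> and \<open>(2,2,1)\<close>;

    \<^item> because \<open>\<Sum> \<lambda>\<^sub>i = 1\<close> and \<open>\<Prod> c\<^sub>i = - 1 / 563\<close>, the series \<open>exp x\<close> belonging to the constant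
      sequence 1 is \<open>- 563 e\<^sub>4\<close>, and \<open>exp x\<close> times the series of \<open>(-1)\<^sup>n Y\<^sub>n\<close>, which is
      \<open>\<Sum> 1 / z\<^sub>i\<close>, is \<open>- 563 e\<^sub>3\<close>.

  Binomial and multinomial convolutions are coefficients of products of these series, so each
  sum in the identity is one symmetric function of degree five in four variables.  That space has
  dimension six (the partitions of five into at most four parts), and
  \<open>p\<^sub>5\<close>, \<open>p\<^sub>4 p\<^sub>1\<close>, \<open>e\<^sub>4 p\<^sub>1\<close>, \<open>p\<^sub>3 p\<^sub>2\<close>, \<open>p\<^sub>3 e\<^sub>2\<close> and \<open>m\<^sub>2\<^sub>2\<^sub>1\<close> form a basis
  of it over the rationals.
  Lemma \<open>degree_five_expansions\<close> writes \<open>p\<^sub>1\<^sup>5\<close> and the ten products weighted by the free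
  parameters \<open>G, J, \<dots>, S\<close> in this basis; the numbers \<open>A, E, F, H, I\<close> are exactly what makes
  the first five basis elements cancel, and \<open>B\<close> is what then remains in front of \<open>m\<^sub>2\<^sub>2\<^sub>1\<close>.

  What is left is to identify the six sequences.  Since \<open>c\<^sub>i\<close> is a polynomial in \<open>\<lambda>\<^sub>i\<close>, so is
  each of its powers, and the sum over the four roots of a cubic polynomial in \<open>\<lambda>\<^sub>i\<close> times
  \<open>\<lambda>\<^sub>i\<^sup>n\<close> is a Tetranacci-type sequence whose initial values are read off from the power sums of
  the roots (\<open>sum_tet_roots_eq_tetra\<close>, \<open>tet_coeff_powers\<close>, \<open>binet\<close>).
\<close>

section \<open>The roots of the characteristic polynomial\<close>

lemma sum_four: "(\<Sum>i\<in>{1..4::nat}. f i) = f 1 + f 2 + f 3 + (f 4 :: 'a::comm_monoid_add)"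
  by (simp add: numeral_eq_Suc add.assoc)

lemma prod_four: "(\<Prod>i\<in>{1..4::nat}. f i) = f 1 * f 2 * f 3 * (f 4 :: 'a::comm_monoid_mult)"
  by (simp add: numeral_eq_Suc mult.assoc)

lemma tet_roots_poly_factor:
  assumes "bij_betw lam {1..4::nat} tet_roots"
  shows "[:-1, -1, -1, -1, 1:] = (\<Prod>i\<in>{1..4}. [:- lam i, 1:])"
proof -
  define p :: "complex poly" where "p = [:-1, -1, -1, -1, 1:]"
  have p: "poly p z = z ^ 4 - z ^ 3 - z ^ 2 - z - 1" for z
    by (simp add: p_def algebra_simps power2_eq_square power3_eq_cube power4_eq_xxxx)
  have dp: "poly (pderiv p) z = 4 * z ^ 3 - 3 * z ^ 2 - 2 * z - 1" for z
    by (simp add: p_def pderiv_pCons algebra_simps power2_eq_square power3_eq_cube)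
  have "rsquarefree p"
    unfolding rsquarefree_roots p dp using tet_roots_simple by blast
  then have "smult (lead_coeff p) (\<Prod>z | poly p z = 0. [:- z, 1:]) = p"
    by (rule complex_poly_decompose_rsquarefree)
  moreover have "lead_coeff p = 1"
    by (simp add: p_def)
  moreover have "{z. poly p z = 0} = tet_roots"
    by (simp add: tet_roots_def p)
  ultimately have "p = (\<Prod>z\<in>tet_roots. [:- z, 1:])"
    by simp
  also have "\<dots> = (\<Prod>i\<in>{1..4}. [:- lam i, 1:])"
    using assms by (rule prod.reindex_bij_betw [symmetric])
  finally show ?thesis
    by (simp add: p_def)
qed

lemma tet_roots_vieta:
  assumes "bij_betw lam {1..4::nat} tet_roots"
  shows "lam 1 + lam 2 + lam 3 + lam 4 = 1"
    and "lam 1 * lam 2 + lam 1 * lam 3 + lam 1 * lam 4 + lam 2 * lam 3 + lam 2 * lam 4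
      + lam 3 * lam 4 = -1"
    and "lam 1 * lam 2 * lam 3 + lam 1 * lam 2 * lam 4 + lam 1 * lam 3 * lam 4
      + lam 2 * lam 3 * lam 4 = 1"
    using tet_roots_poly_factor [OF assms] unfolding prod_four
    by (simp_all add: algebra_simps) (algebra+)

lemma tet_roots_power_sums:
  assumes "bij_betw lam {1..4::nat} tet_roots"
  shows "(\<Sum>i\<in>{1..4}. lam i) = 1" and "(\<Sum>i\<in>{1..4}. lam i ^ 2) = 3"
    and "(\<Sum>i\<in>{1..4}. lam i ^ 3) = 7"
  using tet_roots_vieta [OF assms] unfolding sum_four by algebra+

lemma tet_root_power4:
  assumes "z \<in> tet_roots"
  shows "z ^ 4 = z ^ 3 + z ^ 2 + z + 1"
  using assms by (simp add: tet_roots_def algebra_simps)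

text \<open>
  Both sides satisfy the Tetranacci recurrence in \<open>n\<close>, so it suffices to compare four initial
  values.  They only involve the power sums of the roots of orders 0 to 6, which are
  4, 1, 3, 7, 15, 26, 51.
\<close>

lemma sum_tet_roots_eq_tetra:
  assumes lam: "bij_betw lam {1..4::nat} tet_roots"
  shows "(\<Sum>i\<in>{1..4}. (a0 + a1 * lam i + a2 * lam i ^ 2 + a3 * lam i ^ 3) * lam i ^ n) =
    tetra (4 * a0 + a1 + 3 * a2 + 7 * a3) (a0 + 3 * a1 + 7 * a2 + 15 * a3)
      (3 * a0 + 7 * a1 + 15 * a2 + 26 * a3) (7 * a0 + 15 * a1 + 26 * a2 + 51 * a3) n"
proof -
  have root: "lam i ^ 4 = lam i ^ 3 + lam i ^ 2 + lam i + 1" if "i \<in> {1..4}" for i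
    using that lam tet_root_power4 bij_betwE by blast
  have rec: "(\<Sum>i\<in>{1..4}. w i * lam i ^ (k + 4)) = (\<Sum>i\<in>{1..4}. w i * lam i ^ (k + 3))
      + (\<Sum>i\<in>{1..4}. w i * lam i ^ (k + 2)) + (\<Sum>i\<in>{1..4}. w i * lam i ^ (k + 1))
      + (\<Sum>i\<in>{1..4}. w i * lam i ^ k)" for w and k
    unfolding sum.distrib [symmetric]
    by (intro sum.cong) (simp_all add: power_add root algebra_simps power2_eq_square)
  note s = tet_roots_power_sums [OF lam]
  have s4: "(\<Sum>i\<in>{1..4}. lam i ^ 4) = 15"
    using rec [of "\<lambda>i. 1" 0] s by (simp add: eval_nat_numeral)
  have s5: "(\<Sum>i\<in>{1..4}. lam i ^ 5) = 26"
    using rec [of "\<lambda>i. 1" 1] s s4 by (simp add: eval_nat_numeral)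
  have s6: "(\<Sum>i\<in>{1..4}. lam i ^ 6) = 51"
    using rec [of "\<lambda>i. 1" 2] s s4 s5 by (simp add: eval_nat_numeral)
  have base: "(\<Sum>i\<in>{1..4}. (a0 + a1 * lam i + a2 * lam i ^ 2 + a3 * lam i ^ 3) * lam i ^ k) =
      a0 * (\<Sum>i\<in>{1..4}. lam i ^ k) + a1 * (\<Sum>i\<in>{1..4}. lam i ^ (k + 1))
      + a2 * (\<Sum>i\<in>{1..4}. lam i ^ (k + 2)) + a3 * (\<Sum>i\<in>{1..4}. lam i ^ (k + 3))" for k
    by (simp add: sum_distrib_left sum.distrib [symmetric] power_add algebra_simps
        power2_eq_square power3_eq_cube)
  show ?thesis
    (is "?s n = tetra ?b0 ?b1 ?b2 ?b3 n")
  proof (induction ?b0 ?b1 ?b2 ?b3 n rule: tetra.induct)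
    case 1
    show ?case using base [of 0] s by (simp add: power2_eq_square)
  next
    case 2
    show ?case using base [of 1] s s4 by (simp add: eval_nat_numeral)
  next
    case 3
    show ?case using base [of 2] s s4 s5 by (simp add: eval_nat_numeral)
  next
    case 4
    show ?case using base [of 3] s s4 s5 s6 by (simp add: eval_nat_numeral)
  next
    case (5 n)
    then show ?case
      using rec [of "\<lambda>i. a0 + a1 * lam i + a2 * lam i ^ 2 + a3 * lam i ^ 3" n]
      by (simp add: eval_nat_numeral)
  qed
qed

section \<open>The coefficients of the Binet formulas\<close>

text \<open>
  Modulo the characteristic polynomial, the extended Euclidean algorithm gives an inverse of
  \<open>- z\<^sup>3 + 6 z - 1\<close> with denominator 563; the powers of this inverse are then reduced to cubic
  polynomials in \<open>z\<close>, which is the shape that \<open>sum_tet_roots_eq_tetra\<close> sums over the roots.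
\<close>

lemma tet_coeff_powers:
  assumes "z \<in> tet_roots"
  shows "- (z ^ 3) + 6 * z - 1 \<noteq> 0"
    and "563 * tet_coeff z = - 87 - 71 * z - 61 * z ^ 2 + 86 * z ^ 3"
    and "563 * tet_coeff z ^ 2 = 6 + 9 * z + 28 * z ^ 2 - 11 * z ^ 3"
    and "563 ^ 2 * tet_coeff z ^ 3 = 512 + 1958 * z - 1220 * z ^ 2 + 1157 * z ^ 3"
    and "563 ^ 2 * tet_coeff z ^ 4 = 248 - 175 * z + 255 * z ^ 2 + 210 * z ^ 3"
    and "563 ^ 3 * tet_coeff z ^ 5 = - 21851 + 24522 * z + 20077 * z ^ 2 + 40593 * z ^ 3"
proof -
  let ?q = "- (z ^ 3) + 6 * z - 1"
  define c where "c = tet_coeff z"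
  note r = tet_root_power4 [OF assms]
  have inv: "?q * (- 87 - 71 * z - 61 * z ^ 2 + 86 * z ^ 3) = 563"
    using r by algebra
  then show nz: "?q \<noteq> 0" by force
  then have "c * ?q = 1"
    by (simp add: c_def tet_coeff_def)
  then have c1: "563 * c = - 87 - 71 * z - 61 * z ^ 2 + 86 * z ^ 3"
    using inv by algebra
  have "563 * (563 * c ^ 2) = (563 * c) * (563 * c)"
    by (simp add: power2_eq_square)
  also have "\<dots> = 563 * (6 + 9 * z + 28 * z ^ 2 - 11 * z ^ 3)"
    unfolding c1 using r by algebra
  finally have c2: "563 * c ^ 2 = 6 + 9 * z + 28 * z ^ 2 - 11 * z ^ 3"
    by (simp only: mult_cancel_left) simp
  have "563 ^ 2 * c ^ 3 = (563 * c) * (563 * c ^ 2)"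
    by (simp add: power2_eq_square power3_eq_cube)
  also have "\<dots> = 512 + 1958 * z - 1220 * z ^ 2 + 1157 * z ^ 3"
    unfolding c1 c2 using r by algebra
  finally have c3: "563 ^ 2 * c ^ 3 = \<dots>" .
  have "563 ^ 2 * c ^ 4 = (563 * c ^ 2) * (563 * c ^ 2)"
    by (simp add: eval_nat_numeral)
  also have "\<dots> = 248 - 175 * z + 255 * z ^ 2 + 210 * z ^ 3"
    unfolding c2 using r by algebra
  finally have c4: "563 ^ 2 * c ^ 4 = \<dots>" .
  have "563 ^ 3 * c ^ 5 = (563 * c) * (563 ^ 2 * c ^ 4)"
    by (simp add: eval_nat_numeral)
  also have "\<dots> = - 21851 + 24522 * z + 20077 * z ^ 2 + 40593 * z ^ 3"
    unfolding c1 c4 using r by algebra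
  finally have c5: "563 ^ 3 * c ^ 5 = \<dots>" .
  show "563 * tet_coeff z = - 87 - 71 * z - 61 * z ^ 2 + 86 * z ^ 3"
    "563 * tet_coeff z ^ 2 = 6 + 9 * z + 28 * z ^ 2 - 11 * z ^ 3"
    "563 ^ 2 * tet_coeff z ^ 3 = 512 + 1958 * z - 1220 * z ^ 2 + 1157 * z ^ 3"
    "563 ^ 2 * tet_coeff z ^ 4 = 248 - 175 * z + 255 * z ^ 2 + 210 * z ^ 3"
    "563 ^ 3 * tet_coeff z ^ 5 = - 21851 + 24522 * z + 20077 * z ^ 2 + 40593 * z ^ 3"
    using c1 c2 c3 c4 c5 unfolding c_def by blast+
qed

lemma binet:
  assumes lam: "bij_betw lam {1..4::nat} tet_roots"
  defines "c \<equiv> \<lambda>i. tet_coeff (lam i)"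
  shows "Tet n = (\<Sum>i\<in>{1..4}. c i * lam i ^ n)"
    and "Useq n = 563 * (\<Sum>i\<in>{1..4}. c i ^ 2 * lam i ^ n)"
    and "Vseq n = 563 * (\<Sum>i\<in>{1..4}. c i ^ 3 * lam i ^ n)"
    and "Wseq n = 563 ^ 2 * (\<Sum>i\<in>{1..4}. c i ^ 4 * lam i ^ n)"
    and "Xseq n = 563 ^ 2 * (\<Sum>i\<in>{1..4}. c i ^ 5 * lam i ^ n)"
    and "Yseq n = (\<Sum>i\<in>{1..4}. inverse (c i) * lam i ^ n)"
proof -
  have mem: "lam i \<in> tet_roots" if "i \<in> {1..4}" for i
    using that lam bij_betwE by blast
  have eq: "d * (\<Sum>i\<in>{1..4}. w i * lam i ^ n) =
      tetra (4 * a0 + a1 + 3 * a2 + 7 * a3) (a0 + 3 * a1 + 7 * a2 + 15 * a3)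
      (3 * a0 + 7 * a1 + 15 * a2 + 26 * a3) (7 * a0 + 15 * a1 + 26 * a2 + 51 * a3) n"
    if "\<And>i. i \<in> {1..4} \<Longrightarrow> d * w i = a0 + a1 * lam i + a2 * lam i ^ 2 + a3 * lam i ^ 3"
    for d a0 a1 a2 a3 and w :: "nat \<Rightarrow> complex"
  proof -
    have "d * (\<Sum>i\<in>{1..4}. w i * lam i ^ n) = (\<Sum>i\<in>{1..4}. (d * w i) * lam i ^ n)"
      by (simp add: sum_distrib_left mult.assoc)
    also have "\<dots> = (\<Sum>i\<in>{1..4}. (a0 + a1 * lam i + a2 * lam i ^ 2 + a3 * lam i ^ 3) * lam i ^ n)"
      using that by (intro sum.cong) simp_all
    finally show ?thesis
      by (simp only: sum_tet_roots_eq_tetra [OF lam])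
  qed
  \<comment> \<open>The arguments of \<open>eq\<close> below are the coefficients from \<open>tet_coeff_powers\<close>, divided by 563 in
    the cases of \<open>T\<close>, \<open>V\<close> and \<open>X\<close>, where the power of 563 there is one more than in the goal.\<close>
  note pw = tet_coeff_powers [OF mem]
  have "1 * c i = (- 87 / 563) + (- 71 / 563) * lam i + (- 61 / 563) * lam i ^ 2 + (86 / 563) * lam i ^ 3"
    if "i \<in> {1..4}" for i
    using arg_cong [OF pw(2) [OF that], of "\<lambda>x. x / 563"]
    by (simp add: c_def diff_divide_distrib add_divide_distrib)
  from eq [OF this] show "Tet n = (\<Sum>i\<in>{1..4}. c i * lam i ^ n)"
    by (simp add: Tet_def)
  show "Useq n = 563 * (\<Sum>i\<in>{1..4}. c i ^ 2 * lam i ^ n)"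
    unfolding Useq_def
    using eq [of 563 "\<lambda>i. c i ^ 2" 6 9 28 "- 11"] pw(3) by (simp add: c_def)
  have "563 * c i ^ 3 = (512 / 563) + (1958 / 563) * lam i + (- 1220 / 563) * lam i ^ 2 + (1157 / 563) * lam i ^ 3"
    if "i \<in> {1..4}" for i
    using arg_cong [OF pw(4) [OF that], of "\<lambda>x. x / 563"]
    by (simp add: c_def diff_divide_distrib add_divide_distrib)
  from eq [OF this] show "Vseq n = 563 * (\<Sum>i\<in>{1..4}. c i ^ 3 * lam i ^ n)"
    by (simp add: Vseq_def)
  show "Wseq n = 563 ^ 2 * (\<Sum>i\<in>{1..4}. c i ^ 4 * lam i ^ n)"
    unfolding Wseq_def
    using eq [of "563 ^ 2" "\<lambda>i. c i ^ 4" 248 "- 175" 255 210] pw(5) by (simp add: c_def)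
  have "563 ^ 2 * c i ^ 5 = (- 21851 / 563) + (24522 / 563) * lam i + (20077 / 563) * lam i ^ 2 + (40593 / 563) * lam i ^ 3"
    if "i \<in> {1..4}" for i
    using arg_cong [OF pw(6) [OF that], of "\<lambda>x. x / 563"]
    by (simp add: c_def diff_divide_distrib add_divide_distrib)
  from eq [OF this] show "Xseq n = 563 ^ 2 * (\<Sum>i\<in>{1..4}. c i ^ 5 * lam i ^ n)"
    by (simp add: Xseq_def)
  show "Yseq n = (\<Sum>i\<in>{1..4}. inverse (c i) * lam i ^ n)"
    unfolding Yseq_def
    using eq [of 1 "\<lambda>i. inverse (c i)" "- 1" 6 0 "- 1"]
    by (simp add: c_def tet_coeff_def)
qed

text \<open>
  The Binet formulas at \<open>n = 0\<close> are the power sums of the \<open>c\<^sub>i\<close>.  As \<open>p\<^sub>1 = T\<^sub>0 = 0\<close>, Newton's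
  formula for \<open>e\<^sub>4\<close> collapses to \<open>(p\<^sub>2\<^sup>2 - 2 p\<^sub>4) / 8\<close> with \<open>p\<^sub>2 = 40 / 563\<close> and
  \<open>p\<^sub>4 = 3052 / 563\<^sup>2\<close>.
\<close>

lemma prod_tet_coeff:
  assumes lam: "bij_betw lam {1..4::nat} tet_roots"
  shows "tet_coeff (lam 1) * tet_coeff (lam 2) * tet_coeff (lam 3) * tet_coeff (lam 4) = - 1 / 563"
proof -
  note b = binet [OF lam, of 0, unfolded sum_four]
  let ?c = "\<lambda>i. tet_coeff (lam i)"
  have p: "?c 1 + ?c 2 + ?c 3 + ?c 4 = 0"
    "?c 1 ^ 2 + ?c 2 ^ 2 + ?c 3 ^ 2 + ?c 4 ^ 2 = 40 / 563"
    "?c 1 ^ 4 + ?c 2 ^ 4 + ?c 3 ^ 4 + ?c 4 ^ 4 = 3052 / 563 ^ 2"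
    using b(1,2,4) by (simp_all add: Tet_def Useq_def Wseq_def algebra_simps eq_divide_eq)
  have newton: "24 * (a * b * c * d) = p1 ^ 4 - 6 * p1 ^ 2 * p2 + 3 * p2 ^ 2
      + 8 * p1 * (a ^ 3 + b ^ 3 + c ^ 3 + d ^ 3) - 6 * p4"
    if "a + b + c + d = p1" "a ^ 2 + b ^ 2 + c ^ 2 + d ^ 2 = p2"
      "a ^ 4 + b ^ 4 + c ^ 4 + d ^ 4 = p4"
    for a b c d p1 p2 p4 :: complex
    unfolding that [symmetric] by algebra
  show ?thesis
    using newton [OF p] by (simp add: power2_eq_square eq_divide_eq mult_eq_0_iff) algebra
qed

section \<open>Sums over compositions as coefficients of products\<close>

definition egf_coeff :: "complex fps \<Rightarrow> nat \<Rightarrow> complex" where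
  "egf_coeff X n = fact n * fps_nth X n"

lemma egf_coeff_linear [simp]:
  "egf_coeff (X + Y) n = egf_coeff X n + egf_coeff Y n"
  "egf_coeff (X - Y) n = egf_coeff X n - egf_coeff Y n"
  "egf_coeff (fps_const d * X) n = d * egf_coeff X n"
  "egf_coeff (numeral w * X) n = numeral w * egf_coeff X n"
  by (simp_all add: egf_coeff_def algebra_simps numeral_fps_const)

lemma egf_coeff_exp [simp]:
  "egf_coeff (fps_const d * fps_exp a) n = d * a ^ n"
  "egf_coeff (fps_exp a) n = a ^ n"
  by (simp_all add: egf_coeff_def)

lemma egf_coeff_sum: "egf_coeff (\<Sum>i\<in>I. X i) n = (\<Sum>i\<in>I. egf_coeff (X i) n)"
  by (simp add: egf_coeff_def fps_sum_nth sum_distrib_left)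

lemma binomial_convolution:
  "(\<Sum>k\<le>n. of_nat (n choose k) * (egf_coeff X k * egf_coeff Y (n - k))) = egf_coeff (X * Y) n"
proof -
  have "of_nat (n choose k) * (egf_coeff X k * egf_coeff Y (n - k)) =
      fact n * (fps_nth X k * fps_nth Y (n - k))" if "k \<le> n" for k
    using binomial_fact [OF that, where ?'a = complex] by (simp add: egf_coeff_def)
  then have "(\<Sum>k\<le>n. of_nat (n choose k) * (egf_coeff X k * egf_coeff Y (n - k))) =
      (\<Sum>k\<le>n. fact n * (fps_nth X k * fps_nth Y (n - k)))"
    by (intro sum.cong) simp_all
  then show ?thesis
    by (simp add: egf_coeff_def fps_mult_nth sum_distrib_left atMost_atLeast0)
qed

text \<open>
  The multinomial sums range over tuples of varying length.  To treat all lengths by one induction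
  step, the index type is left arbitrary and only its total \<open>w\<close> matters: the coefficients of \<open>Y\<close>
  are the sums of \<open>g\<close> over the finite fibres of \<open>w\<close>.
\<close>

definition weighted_nth :: "('b \<Rightarrow> nat) \<Rightarrow> ('b \<Rightarrow> complex) \<Rightarrow> complex fps \<Rightarrow> bool" where
  "weighted_nth w g Y \<longleftrightarrow>
     (\<forall>m. finite {r. w r = m} \<and> (\<Sum>r | w r = m. g r) = fps_nth Y m)"

lemma weighted_nth_mult:
  fixes w :: "'b \<Rightarrow> nat"
  assumes "weighted_nth w g Y"
  shows "weighted_nth (\<lambda>(k, r). k + w r) (\<lambda>(k, r). fps_nth X k * g r) (X * Y)"
  unfolding weighted_nth_def
proof (intro allI conjI)
  fix m
  have fin: "finite {r. w r = k}" and nth: "(\<Sum>r | w r = k. g r) = fps_nth Y k" for k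
    using assms by (auto simp: weighted_nth_def)
  have eq: "{x. (case x of (k, r) \<Rightarrow> k + w r) = m} = (SIGMA k:{..m}. {r. w r = m - k})"
    by auto
  show "finite {x. (case x of (k, r) \<Rightarrow> k + w r) = m}"
    unfolding eq using fin by blast
  show "(\<Sum>x | (case x of (k, r) \<Rightarrow> k + w r) = m. case x of (k, r) \<Rightarrow> fps_nth X k * g r) =
      fps_nth (X * Y) m"
    unfolding eq using fin
    by (simp add: sum.Sigma [symmetric] sum_distrib_left [symmetric] nth fps_mult_nth
        atMost_atLeast0)
qed

lemma weighted_nth_single: "weighted_nth (\<lambda>k. k) (fps_nth X) X"
  by (simp add: weighted_nth_def)

text \<open>
  Multiplying the ordinary Cauchy product by \<open>n!\<close> turns it into the multinomial convolution.  The
  summand is an arbitrary \<open>f\<close>, with a constant \<open>d\<close>, so that the rules apply to summands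
  whose powers and sequence values are interleaved in any order.
\<close>

lemma multinomial_convolution3:
  assumes "\<And>k1 k2 k3. f k1 k2 k3 =
    d * (multinom n [k1, k2, k3] * (egf_coeff X1 k1 * egf_coeff X2 k2 * egf_coeff X3 k3))"
  shows "(\<Sum>(k1, k2, k3)\<in>{(k1, k2, k3). k1 + k2 + k3 = n}. f k1 k2 k3) =
    d * egf_coeff (X1 * X2 * X3) n"
proof -
  have "weighted_nth (\<lambda>(k1, k2, k3). k1 + (k2 + k3))
      (\<lambda>(k1, k2, k3). fps_nth X1 k1 * (fps_nth X2 k2 * fps_nth X3 k3)) (X1 * (X2 * X3))"
    using weighted_nth_mult [OF weighted_nth_mult [OF weighted_nth_single]]
    by (simp add: case_prod_unfold)
  then have "(\<Sum>(k1, k2, k3)\<in>{(k1, k2, k3). k1 + k2 + k3 = n}.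
      fps_nth X1 k1 * (fps_nth X2 k2 * fps_nth X3 k3)) = fps_nth (X1 * (X2 * X3)) n"
    unfolding weighted_nth_def by (simp add: case_prod_unfold add.assoc)
  then show ?thesis
    by (simp add: assms multinom_def egf_coeff_def sum_distrib_left mult.assoc case_prod_beta
        flip: sum_distrib_left)
qed

lemma multinomial_convolution4:
  assumes "\<And>k1 k2 k3 k4. f k1 k2 k3 k4 = d * (multinom n [k1, k2, k3, k4] *
    (egf_coeff X1 k1 * egf_coeff X2 k2 * egf_coeff X3 k3 * egf_coeff X4 k4))"
  shows "(\<Sum>(k1, k2, k3, k4)\<in>{(k1, k2, k3, k4). k1 + k2 + k3 + k4 = n}. f k1 k2 k3 k4) =
    d * egf_coeff (X1 * X2 * X3 * X4) n"
proof -
  have "weighted_nth (\<lambda>(k1, k2, k3, k4). k1 + (k2 + (k3 + k4)))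
      (\<lambda>(k1, k2, k3, k4). fps_nth X1 k1 * (fps_nth X2 k2 * (fps_nth X3 k3 * fps_nth X4 k4)))
      (X1 * (X2 * (X3 * X4)))"
    using weighted_nth_mult [OF weighted_nth_mult [OF weighted_nth_mult [OF weighted_nth_single]]]
    by (simp add: case_prod_unfold)
  then have "(\<Sum>(k1, k2, k3, k4)\<in>{(k1, k2, k3, k4). k1 + k2 + k3 + k4 = n}.
      fps_nth X1 k1 * (fps_nth X2 k2 * (fps_nth X3 k3 * fps_nth X4 k4))) =
      fps_nth (X1 * (X2 * (X3 * X4))) n"
    unfolding weighted_nth_def by (simp add: case_prod_unfold add.assoc)
  then show ?thesis
    by (simp add: assms multinom_def egf_coeff_def sum_distrib_left mult.assoc case_prod_beta
        flip: sum_distrib_left)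
qed

lemma multinomial_convolution5:
  assumes "\<And>k1 k2 k3 k4 k5. f k1 k2 k3 k4 k5 = d * (multinom n [k1, k2, k3, k4, k5] *
    (egf_coeff X1 k1 * egf_coeff X2 k2 * egf_coeff X3 k3 * egf_coeff X4 k4 * egf_coeff X5 k5))"
  shows "(\<Sum>(k1, k2, k3, k4, k5)\<in>{(k1, k2, k3, k4, k5). k1 + k2 + k3 + k4 + k5 = n}.
    f k1 k2 k3 k4 k5) = d * egf_coeff (X1 * X2 * X3 * X4 * X5) n"
proof -
  have "weighted_nth (\<lambda>(k1, k2, k3, k4, k5). k1 + (k2 + (k3 + (k4 + k5))))
      (\<lambda>(k1, k2, k3, k4, k5).
        fps_nth X1 k1 * (fps_nth X2 k2 * (fps_nth X3 k3 * (fps_nth X4 k4 * fps_nth X5 k5))))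
      (X1 * (X2 * (X3 * (X4 * X5))))"
    using weighted_nth_mult [OF weighted_nth_mult [OF weighted_nth_mult
      [OF weighted_nth_mult [OF weighted_nth_single]]]]
    by (simp add: case_prod_unfold)
  then have "(\<Sum>(k1, k2, k3, k4, k5)\<in>{(k1, k2, k3, k4, k5). k1 + k2 + k3 + k4 + k5 = n}.
      fps_nth X1 k1 * (fps_nth X2 k2 * (fps_nth X3 k3 * (fps_nth X4 k4 * fps_nth X5 k5)))) =
      fps_nth (X1 * (X2 * (X3 * (X4 * X5)))) n"
    unfolding weighted_nth_def by (simp add: case_prod_unfold add.assoc)
  then show ?thesis
    by (simp add: assms multinom_def egf_coeff_def sum_distrib_left mult.assoc case_prod_beta
        flip: sum_distrib_left)
qed

section \<open>Symmetric functions of degree five in four variables\<close>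

definition psum :: "(nat \<Rightarrow> 'a) \<Rightarrow> nat \<Rightarrow> 'a::comm_ring_1" where
  "psum z k = (\<Sum>i\<in>{1..4}. z i ^ k)"

definition esym2 :: "(nat \<Rightarrow> 'a) \<Rightarrow> 'a::comm_ring_1" where
  "esym2 z = z 1 * z 2 + z 1 * z 3 + z 1 * z 4 + z 2 * z 3 + z 2 * z 4 + z 3 * z 4"

definition esym3 :: "(nat \<Rightarrow> 'a) \<Rightarrow> 'a::comm_ring_1" where
  "esym3 z = z 1 * z 2 * z 3 + z 1 * z 2 * z 4 + z 1 * z 3 * z 4 + z 2 * z 3 * z 4"

definition esym4 :: "(nat \<Rightarrow> 'a) \<Rightarrow> 'a::comm_ring_1" where
  "esym4 z = z 1 * z 2 * z 3 * z 4"

definition mono211 :: "(nat \<Rightarrow> 'a) \<Rightarrow> 'a::comm_ring_1" where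
  "mono211 z = z 1 * z 2 * z 3 * (z 1 + z 2 + z 3) + z 1 * z 2 * z 4 * (z 1 + z 2 + z 4)
     + z 1 * z 3 * z 4 * (z 1 + z 3 + z 4) + z 2 * z 3 * z 4 * (z 2 + z 3 + z 4)"

definition mono221 :: "(nat \<Rightarrow> 'a) \<Rightarrow> 'a::comm_ring_1" where
  "mono221 z = z 1 * z 2 * z 3 * (z 1 * z 2 + z 2 * z 3 + z 3 * z 1)
     + z 1 * z 2 * z 4 * (z 1 * z 2 + z 2 * z 4 + z 4 * z 1)
     + z 1 * z 3 * z 4 * (z 1 * z 3 + z 3 * z 4 + z 4 * z 1)
     + z 2 * z 3 * z 4 * (z 2 * z 3 + z 3 * z 4 + z 4 * z 2)"

text \<open>
  Expansions in the basis \<open>p\<^sub>5\<close>, \<open>p\<^sub>4 p\<^sub>1\<close>, \<open>e\<^sub>4 p\<^sub>1\<close>, \<open>p\<^sub>3 p\<^sub>2\<close>, \<open>p\<^sub>3 e\<^sub>2\<close>, \<open>m\<^sub>2\<^sub>2\<^sub>1\<close>.  The numbers in the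
  first one are the constant terms of \<open>A, E, F, H, I, B\<close>, and those in the others are the
  coefficients of \<open>G, J, K, L, M, N, P, Q, R, S\<close> in them, in this order and up to sign.
  Products are spelled out factor by factor because each factor stands for one index of a
  multinomial sum.
\<close>

lemma degree_five_expansions:
  fixes z :: "nat \<Rightarrow> 'a::idom"
  defines "p \<equiv> psum z"
  shows "p 1 * p 1 * p 1 * p 1 * p 1 = 6 * p 5 - 15 * (p 4 * p 1) + 60 * (esym4 z * p 1)
      + 10 * (p 3 * p 2) + 20 * (p 3 * esym2 z) + 30 * mono221 z"
    and "mono211 z * p 1 = p 5 - p 4 * p 1 + 3 * (esym4 z * p 1) + p 3 * esym2 z + 2 * mono221 z"
    and "esym3 z * p 2 = p 5 - p 4 * p 1 + esym4 z * p 1 + p 3 * esym2 z"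
    and "esym3 z * esym2 z = 3 * (esym4 z * p 1) + mono221 z"
    and "p 3 * p 1 * p 1 = p 3 * p 2 + 2 * (p 3 * esym2 z)"
    and "esym3 z * p 1 * p 1 = p 5 - p 4 * p 1 + 7 * (esym4 z * p 1) + p 3 * esym2 z
      + 2 * mono221 z"
    and "p 2 * p 2 * p 1 = p 4 * p 1 - 2 * p 5 + 2 * (p 3 * p 2) + 2 * mono221 z"
    and "esym2 z * esym2 z * p 1 = p 5 - 2 * (p 4 * p 1) + 12 * (esym4 z * p 1) + p 3 * p 2
      + 2 * (p 3 * esym2 z) + 5 * mono221 z"
    and "p 2 * esym2 z * p 1 = p 5 - 2 * (p 4 * p 1) + 3 * (esym4 z * p 1) + p 3 * p 2
      + 3 * (p 3 * esym2 z) + 2 * mono221 z"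
    and "p 2 * p 1 * p 1 * p 1 = 6 * (esym4 z * p 1) - 3 * (p 4 * p 1) + 4 * (p 3 * p 2)
      + 6 * (p 3 * esym2 z) + 6 * mono221 z"
    and "esym2 z * p 1 * p 1 * p 1 = 3 * p 5 - 6 * (p 4 * p 1) + 27 * (esym4 z * p 1)
      + 3 * (p 3 * p 2) + 7 * (p 3 * esym2 z) + 12 * mono221 z"
  unfolding p_def psum_def sum_four esym2_def esym3_def esym4_def mono211_def mono221_def
  by algebra+

section \<open>The four exponentials\<close>

definition tet_exp :: "(nat \<Rightarrow> complex) \<Rightarrow> nat \<Rightarrow> complex fps" where
  "tet_exp lam i = fps_const (tet_coeff (lam i)) * fps_exp (lam i)"

text \<open>
  The sum of the reciprocals of the four exponentials, that is \<open>e\<^sub>3 / e\<^sub>4\<close>; this is where the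
  factor \<open>(-1)\<^sup>n\<close> in front of \<open>Y\<^sub>n\<close> comes from.
\<close>

definition tet_exp_recip :: "(nat \<Rightarrow> complex) \<Rightarrow> complex fps" where
  "tet_exp_recip lam =
     (\<Sum>i\<in>{1..4}. fps_const (inverse (tet_coeff (lam i))) * fps_exp (- lam i))"

lemma egf_coeff_psum:
  "egf_coeff (psum (tet_exp lam) k) n =
    of_nat k ^ n * (\<Sum>i\<in>{1..4}. tet_coeff (lam i) ^ k * lam i ^ n)"
  by (simp add: psum_def tet_exp_def egf_coeff_sum power_mult_distrib fps_const_power
      fps_exp_power_mult sum_distrib_left mult.left_commute)

lemma egf_coeff_tetra:
  assumes lam: "bij_betw lam {1..4::nat} tet_roots"
  defines "p \<equiv> psum (tet_exp lam)"
  shows "egf_coeff (p 1) n = Tet n"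
    and "egf_coeff (p 2) n = 2 ^ n * Useq n / 563"
    and "egf_coeff (p 3) n = 3 ^ n * Vseq n / 563"
    and "egf_coeff (p 4) n = 4 ^ n * Wseq n / 563 ^ 2"
    and "egf_coeff (p 5) n = 5 ^ n * Xseq n / 563 ^ 2"
    and "egf_coeff (tet_exp_recip lam) n = (- 1) ^ n * Yseq n"
proof -
  have "(- 1) ^ n * lam i ^ n = (- lam i) ^ n" for i
    by (simp flip: power_mult_distrib)
  then show "egf_coeff (tet_exp_recip lam) n = (- 1) ^ n * Yseq n"
    by (simp add: binet [OF lam] tet_exp_recip_def egf_coeff_sum sum_distrib_left
        mult.left_commute)
qed (simp_all add: p_def egf_coeff_psum binet [OF lam])

lemma egf_coeff_esym2:
  assumes lam: "bij_betw lam {1..4::nat} tet_roots"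
  shows "egf_coeff (esym2 (tet_exp lam)) n = tseq n"
proof -
  let ?p = "psum (tet_exp lam)"
  have "?p 1 * ?p 1 - ?p 2 = 2 * esym2 (tet_exp lam)"
    unfolding psum_def sum_four esym2_def by algebra
  then have "egf_coeff (?p 1 * ?p 1) n - egf_coeff (?p 2) n = 2 * egf_coeff (esym2 (tet_exp lam)) n"
    by (metis egf_coeff_linear(2,4))
  moreover have "egf_coeff (?p 1 * ?p 1) n = (\<Sum>k\<le>n. of_nat (n choose k) * Tet k * Tet (n - k))"
    by (simp only: egf_coeff_tetra(1) [OF lam] binomial_convolution [symmetric] mult.assoc)
  ultimately show ?thesis
    by (simp add: tseq_def egf_coeff_tetra(2) [OF lam])
qed

lemma sum_triples:
  "(\<Sum>(i, j, l)\<in>triples. f i j l) = f 1 2 3 + f 1 2 4 + f 1 3 4 + (f 2 3 4 :: 'a::comm_monoid_add)"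
proof -
  have eq: "triples = {(1, 2, 3), (1, 2, 4), (1, 3, 4), (2, 3, 4)}"
    unfolding triples_def by auto
  show ?thesis
    unfolding eq by (simp add: add.assoc)
qed

lemma t1seq_eq_egf_coeff: "t1seq lam n = egf_coeff (mono211 (tet_exp lam)) n"
  by (simp add: t1seq_def egf_coeff_def egf1_def Let_def sum_triples mono211_def tet_exp_def
      fps_exp_add_mult fps_const_mult [symmetric] mult_ac del: fps_const_mult)

lemma t2seq_eq_egf_coeff: "t2seq lam n = egf_coeff (mono221 (tet_exp lam)) n"
  by (simp add: t2seq_def egf_coeff_def egf2_def Let_def sum_triples mono221_def tet_exp_def
      fps_exp_add_mult fps_const_mult [symmetric] mult_ac del: fps_const_mult)

text \<open>
  The exponents of the four factors add up to \<open>\<Sum> \<lambda>\<^sub>i = 1\<close>.  This accounts for every index of a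
  multinomial sum at which no sequence is evaluated.
\<close>

lemma esym4_tet_exp:
  assumes lam: "bij_betw lam {1..4::nat} tet_roots"
  shows "fps_exp 1 = fps_const (- 563) * esym4 (tet_exp lam)"
proof -
  have "esym4 (tet_exp lam) = fps_const (tet_coeff (lam 1) * tet_coeff (lam 2) * tet_coeff (lam 3)
      * tet_coeff (lam 4)) * fps_exp (lam 1 + lam 2 + lam 3 + lam 4)"
    by (simp add: esym4_def tet_exp_def fps_exp_add_mult fps_const_mult [symmetric] mult_ac
        del: fps_const_mult)
  then show ?thesis
    by (simp only: prod_tet_coeff [OF lam] tet_roots_vieta(1) [OF lam]) (simp flip: mult.assoc)
qed

text \<open>Multiplying \<open>e\<^sub>4\<close> by \<open>1 / z\<^sub>i\<close> removes one factor, and the four results add up to \<open>e\<^sub>3\<close>.\<close>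

lemma esym3_tet_exp:
  assumes lam: "bij_betw lam {1..4::nat} tet_roots"
  shows "tet_exp_recip lam * fps_exp 1 = fps_const (- 563) * esym3 (tet_exp lam)"
proof -
  have inv: "fps_const (inverse (tet_coeff (lam i))) * fps_exp (- lam i) * tet_exp lam i = 1"
    if "i \<in> {1..4}" for i
  proof -
    have "lam i \<in> tet_roots"
      using that lam bij_betwE by blast
    then have "tet_coeff (lam i) \<noteq> 0"
      using tet_coeff_powers(1) by (simp add: tet_coeff_def)
    then have "fps_const (inverse (tet_coeff (lam i))) * fps_const (tet_coeff (lam i)) = 1"
      by simp
    moreover have "fps_exp (- lam i) * fps_exp (lam i) = (1 :: complex fps)"
      by (simp flip: fps_exp_add_mult)
    ultimately show ?thesis
      unfolding tet_exp_def by algebra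
  qed
  show ?thesis
    unfolding esym4_tet_exp [OF lam] tet_exp_recip_def sum_four esym3_def esym4_def
    using inv [of 1] inv [of 2] inv [of 3] inv [of 4] by simp algebra
qed

section \<open>The identity\<close>

theorem theorem7:
  fixes lam :: "nat \<Rightarrow> complex"
    and A B E F G H I J K L M N P Q R S :: complex
    and n :: nat
  assumes lam: "bij_betw lam {1..4} tet_roots"
    and A: "A = - G - J - M + 2 * N - P - Q - 3 * S + 6"
    and B: "B = - 2 * G - K - 2 * M - 2 * N - 5 * P - 2 * Q - 6 * R - 12 * S + 30"
    and E: "E = G + J + M - N + 2 * P + 2 * Q + 3 * R + 6 * S - 15"
    and F: "F = - 3 * G - J - 3 * K - 7 * M - 12 * P - 3 * Q - 6 * R - 27 * S + 60"
    and H: "H = - L - 2 * N - P - Q - 4 * R - 3 * S + 10"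
    and I: "I = - G - J - 2 * L - M - 2 * P - 3 * Q - 6 * R - 7 * S + 20"
    and "B \<noteq> 0"
  shows "B * t2seq lam n =
      (\<Sum>(k1, k2, k3, k4, k5)\<in>{(k1, k2, k3, k4, k5). k1 + k2 + k3 + k4 + k5 = n}.
          multinom n [k1, k2, k3, k4, k5] * Tet k1 * Tet k2 * Tet k3 * Tet k4 * Tet k5)
    - A / 563 ^ 2 * 5 ^ n * Xseq n
    - E / 563 ^ 2 * (\<Sum>k\<le>n. of_nat (n choose k) * 4 ^ (n - k) * Wseq (n - k) * Tet k)
    + F / 563 * (\<Sum>k\<le>n. of_nat (n choose k) * Tet k)
    - G * (\<Sum>k\<le>n. of_nat (n choose k) * t1seq lam k * Tet (n - k))
    - H / 563 ^ 2 * (\<Sum>k\<le>n. of_nat (n choose k) * 3 ^ (n - k) * 2 ^ k * Vseq (n - k) * Useq k)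
    - I / 563 * (\<Sum>k\<le>n. of_nat (n choose k) * 3 ^ k * Vseq k * tseq (n - k))
    + J / 563 ^ 2 * (\<Sum>(k1, k2, k3)\<in>{(k1, k2, k3). k1 + k2 + k3 = n}.
          multinom n [k1, k2, k3] * (- 1) ^ k1 * 2 ^ k2 * Yseq k1 * Useq k2)
    + K / 563 * (\<Sum>(k1, k2, k3)\<in>{(k1, k2, k3). k1 + k2 + k3 = n}.
          multinom n [k1, k2, k3] * (- 1) ^ k1 * Yseq k1 * tseq k2)
    - L / 563 * (\<Sum>(k1, k2, k3)\<in>{(k1, k2, k3). k1 + k2 + k3 = n}.
          multinom n [k1, k2, k3] * 3 ^ k1 * Vseq k1 * Tet k2 * Tet k3)
    + M / 563 * (\<Sum>(k1, k2, k3, k4)\<in>{(k1, k2, k3, k4). k1 + k2 + k3 + k4 = n}.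
          multinom n [k1, k2, k3, k4] * (- 1) ^ k1 * Yseq k1 * Tet k2 * Tet k3)
    - N / 563 ^ 2 * (\<Sum>(k1, k2, k3)\<in>{(k1, k2, k3). k1 + k2 + k3 = n}.
          multinom n [k1, k2, k3] * 2 ^ k1 * Useq k1 * 2 ^ k2 * Useq k2 * Tet k3)
    - P * (\<Sum>(k1, k2, k3)\<in>{(k1, k2, k3). k1 + k2 + k3 = n}.
          multinom n [k1, k2, k3] * tseq k1 * tseq k2 * Tet k3)
    - Q / 563 * (\<Sum>(k1, k2, k3)\<in>{(k1, k2, k3). k1 + k2 + k3 = n}.
          multinom n [k1, k2, k3] * 2 ^ k1 * Useq k1 * tseq k2 * Tet k3)
    - R / 563 * (\<Sum>(k1, k2, k3, k4)\<in>{(k1, k2, k3, k4). k1 + k2 + k3 + k4 = n}.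
          multinom n [k1, k2, k3, k4] * 2 ^ k1 * Useq k1 * Tet k2 * Tet k3 * Tet k4)
    - S * (\<Sum>(k1, k2, k3, k4)\<in>{(k1, k2, k3, k4). k1 + k2 + k3 + k4 = n}.
          multinom n [k1, k2, k3, k4] * tseq k1 * Tet k2 * Tet k3 * Tet k4)"
proof -
  \<comment> \<open>\<open>x\<close> is the series of the constant sequence 1; it fills the indices without a sequence.\<close>
  define p1 p2 p3 p4 p5 e2 e3 e4 m1 m2 Y x where defs:
    "p1 = psum (tet_exp lam) 1" "p2 = psum (tet_exp lam) 2" "p3 = psum (tet_exp lam) 3"
    "p4 = psum (tet_exp lam) 4" "p5 = psum (tet_exp lam) 5" "e2 = esym2 (tet_exp lam)"
    "e3 = esym3 (tet_exp lam)" "e4 = esym4 (tet_exp lam)" "m1 = mono211 (tet_exp lam)"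
    "m2 = mono221 (tet_exp lam)" "Y = tet_exp_recip lam" "x = (fps_exp 1 :: complex fps)"
  let ?f = "\<lambda>X. egf_coeff X n"
  have coeffs: "egf_coeff p1 k = Tet k" "egf_coeff p2 k = 2 ^ k * Useq k / 563"
    "egf_coeff p3 k = 3 ^ k * Vseq k / 563" "egf_coeff p4 k = 4 ^ k * Wseq k / 563 ^ 2"
    "egf_coeff p5 k = 5 ^ k * Xseq k / 563 ^ 2" "egf_coeff Y k = (- 1) ^ k * Yseq k"
    "egf_coeff e2 k = tseq k" "egf_coeff m1 k = t1seq lam k" "egf_coeff m2 k = t2seq lam k"
    "egf_coeff x k = 1" for k
    unfolding defs by (simp_all only: egf_coeff_tetra [OF lam] egf_coeff_esym2 [OF lam]
        t1seq_eq_egf_coeff t2seq_eq_egf_coeff egf_coeff_exp power_one)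
  note expand = degree_five_expansions [of "tet_exp lam", folded defs]
  have x: "x = fps_const (- 563) * e4" and Yx: "Y * x = fps_const (- 563) * e3"
    unfolding defs using esym4_tet_exp [OF lam] esym3_tet_exp [OF lam] by blast+
  have sE: "(\<Sum>k\<le>n. of_nat (n choose k) * 4 ^ (n - k) * Wseq (n - k) * Tet k) =
      563 ^ 2 * ?f (p4 * p1)"
  proof -
    have "(\<Sum>k\<le>n. of_nat (n choose k) * 4 ^ (n - k) * Wseq (n - k) * Tet k) =
        563 ^ 2 * (\<Sum>k\<le>n. of_nat (n choose k) * (egf_coeff p1 k * egf_coeff p4 (n - k)))"
      unfolding sum_distrib_left coeffs by (intro sum.cong) simp_all
    then show ?thesis
      by (simp add: binomial_convolution mult.commute)
  qed
  have sF: "(\<Sum>k\<le>n. of_nat (n choose k) * Tet k) =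
      - 563 * ?f (e4 * p1)"
  proof -
    have "(\<Sum>k\<le>n. of_nat (n choose k) * Tet k) =
        1 * (\<Sum>k\<le>n. of_nat (n choose k) * (egf_coeff p1 k * egf_coeff x (n - k)))"
      unfolding sum_distrib_left coeffs by (intro sum.cong) simp_all
    also have "\<dots> = ?f (p1 * x)"
      by (simp add: binomial_convolution)
    also have "p1 * x = fps_const (- 563) * (e4 * p1)"
      by (simp add: x mult_ac)
    finally show ?thesis by simp
  qed
  have sG: "(\<Sum>k\<le>n. of_nat (n choose k) * t1seq lam k * Tet (n - k)) =
      1 * ?f (m1 * p1)"
  proof -
    have "(\<Sum>k\<le>n. of_nat (n choose k) * t1seq lam k * Tet (n - k)) =
        1 * (\<Sum>k\<le>n. of_nat (n choose k) * (egf_coeff m1 k * egf_coeff p1 (n - k)))"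
      unfolding sum_distrib_left coeffs by (intro sum.cong) simp_all
    then show ?thesis
      by (simp add: binomial_convolution mult.commute)
  qed
  have sH: "(\<Sum>k\<le>n. of_nat (n choose k) * 3 ^ (n - k) * 2 ^ k * Vseq (n - k) * Useq k) =
      563 ^ 2 * ?f (p3 * p2)"
  proof -
    have "(\<Sum>k\<le>n. of_nat (n choose k) * 3 ^ (n - k) * 2 ^ k * Vseq (n - k) * Useq k) =
        563 ^ 2 * (\<Sum>k\<le>n. of_nat (n choose k) * (egf_coeff p2 k * egf_coeff p3 (n - k)))"
      unfolding sum_distrib_left coeffs by (intro sum.cong) simp_all
    then show ?thesis
      by (simp add: binomial_convolution mult.commute)
  qed
  have sI: "(\<Sum>k\<le>n. of_nat (n choose k) * 3 ^ k * Vseq k * tseq (n - k)) =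
      563 * ?f (p3 * e2)"
  proof -
    have "(\<Sum>k\<le>n. of_nat (n choose k) * 3 ^ k * Vseq k * tseq (n - k)) =
        563 * (\<Sum>k\<le>n. of_nat (n choose k) * (egf_coeff p3 k * egf_coeff e2 (n - k)))"
      unfolding sum_distrib_left coeffs by (intro sum.cong) simp_all
    then show ?thesis
      by (simp add: binomial_convolution mult.commute)
  qed
  have sbase: "(\<Sum>(k1, k2, k3, k4, k5)\<in>{(k1, k2, k3, k4, k5). k1 + k2 + k3 + k4 + k5 = n}.
          multinom n [k1, k2, k3, k4, k5] * Tet k1 * Tet k2 * Tet k3 * Tet k4 * Tet k5) =
      1 * ?f (p1 * p1 * p1 * p1 * p1)"
    by (rule multinomial_convolution5) (simp add: coeffs)
  have sJ: "(\<Sum>(k1, k2, k3)\<in>{(k1, k2, k3). k1 + k2 + k3 = n}.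
          multinom n [k1, k2, k3] * (- 1) ^ k1 * 2 ^ k2 * Yseq k1 * Useq k2) =
      - (563 ^ 2) * ?f (e3 * p2)"
  proof -
    have "(\<Sum>(k1, k2, k3)\<in>{(k1, k2, k3). k1 + k2 + k3 = n}.
          multinom n [k1, k2, k3] * (- 1) ^ k1 * 2 ^ k2 * Yseq k1 * Useq k2) =
      563 * ?f (Y * p2 * x)"
      by (rule multinomial_convolution3) (simp add: coeffs)
    also have "Y * p2 * x = fps_const (- 563) * (e3 * p2)"
      using Yx by algebra
    finally show ?thesis by simp
  qed
  have sK: "(\<Sum>(k1, k2, k3)\<in>{(k1, k2, k3). k1 + k2 + k3 = n}.
          multinom n [k1, k2, k3] * (- 1) ^ k1 * Yseq k1 * tseq k2) =
      - 563 * ?f (e3 * e2)"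
  proof -
    have "(\<Sum>(k1, k2, k3)\<in>{(k1, k2, k3). k1 + k2 + k3 = n}.
          multinom n [k1, k2, k3] * (- 1) ^ k1 * Yseq k1 * tseq k2) =
      1 * ?f (Y * e2 * x)"
      by (rule multinomial_convolution3) (simp add: coeffs)
    also have "Y * e2 * x = fps_const (- 563) * (e3 * e2)"
      using Yx by algebra
    finally show ?thesis by simp
  qed
  have sL: "(\<Sum>(k1, k2, k3)\<in>{(k1, k2, k3). k1 + k2 + k3 = n}.
          multinom n [k1, k2, k3] * 3 ^ k1 * Vseq k1 * Tet k2 * Tet k3) =
      563 * ?f (p3 * p1 * p1)"
    by (rule multinomial_convolution3) (simp add: coeffs)
  have sM: "(\<Sum>(k1, k2, k3, k4)\<in>{(k1, k2, k3, k4). k1 + k2 + k3 + k4 = n}.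
          multinom n [k1, k2, k3, k4] * (- 1) ^ k1 * Yseq k1 * Tet k2 * Tet k3) =
      - 563 * ?f (e3 * p1 * p1)"
  proof -
    have "(\<Sum>(k1, k2, k3, k4)\<in>{(k1, k2, k3, k4). k1 + k2 + k3 + k4 = n}.
          multinom n [k1, k2, k3, k4] * (- 1) ^ k1 * Yseq k1 * Tet k2 * Tet k3) =
      1 * ?f (Y * p1 * p1 * x)"
      by (rule multinomial_convolution4) (simp add: coeffs)
    also have "Y * p1 * p1 * x = fps_const (- 563) * (e3 * p1 * p1)"
      using Yx by algebra
    finally show ?thesis by simp
  qed
  have sN: "(\<Sum>(k1, k2, k3)\<in>{(k1, k2, k3). k1 + k2 + k3 = n}.
          multinom n [k1, k2, k3] * 2 ^ k1 * Useq k1 * 2 ^ k2 * Useq k2 * Tet k3) =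
      563 ^ 2 * ?f (p2 * p2 * p1)"
    by (rule multinomial_convolution3) (simp add: coeffs)
  have sP: "(\<Sum>(k1, k2, k3)\<in>{(k1, k2, k3). k1 + k2 + k3 = n}.
          multinom n [k1, k2, k3] * tseq k1 * tseq k2 * Tet k3) =
      1 * ?f (e2 * e2 * p1)"
    by (rule multinomial_convolution3) (simp add: coeffs)
  have sQ: "(\<Sum>(k1, k2, k3)\<in>{(k1, k2, k3). k1 + k2 + k3 = n}.
          multinom n [k1, k2, k3] * 2 ^ k1 * Useq k1 * tseq k2 * Tet k3) =
      563 * ?f (p2 * e2 * p1)"
    by (rule multinomial_convolution3) (simp add: coeffs)
  have sR: "(\<Sum>(k1, k2, k3, k4)\<in>{(k1, k2, k3, k4). k1 + k2 + k3 + k4 = n}.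
          multinom n [k1, k2, k3, k4] * 2 ^ k1 * Useq k1 * Tet k2 * Tet k3 * Tet k4) =
      563 * ?f (p2 * p1 * p1 * p1)"
    by (rule multinomial_convolution4) (simp add: coeffs)
  have sS: "(\<Sum>(k1, k2, k3, k4)\<in>{(k1, k2, k3, k4). k1 + k2 + k3 + k4 = n}.
          multinom n [k1, k2, k3, k4] * tseq k1 * Tet k2 * Tet k3 * Tet k4) =
      1 * ?f (e2 * p1 * p1 * p1)"
    by (rule multinomial_convolution4) (simp add: coeffs)
  have lin: "?f (X + Z) = ?f X + ?f Z" "?f (X - Z) = ?f X - ?f Z"
    "?f (numeral w * X) = numeral w * ?f X" for X Z w
    by simp_all
  have A5: "5 ^ n * Xseq n = 563 ^ 2 * ?f p5" and t2: "t2seq lam n = ?f m2"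
    by (simp_all add: coeffs)
  \<comment> \<open>Expanding everything in the basis makes both sides linear in the coefficients of the six basis
    elements; the definitions of \<open>A, B, E, F, H, I\<close> then match them one by one.  The terms
    with \<open>F\<close>, \<open>J\<close>, \<open>K\<close> and \<open>M\<close> carry the sign of \<open>- 563\<close> from \<open>e\<^sub>3\<close> and \<open>e\<^sub>4\<close>.\<close>
  have combination: "B * ?f m2 = ?f (p1 * p1 * p1 * p1 * p1) - A * ?f p5 - E * ?f (p4 * p1)
      - F * ?f (e4 * p1) - G * ?f (m1 * p1) - H * ?f (p3 * p2) - I * ?f (p3 * e2)
      - J * ?f (e3 * p2) - K * ?f (e3 * e2) - L * ?f (p3 * p1 * p1) - M * ?f (e3 * p1 * p1)
      - N * ?f (p2 * p2 * p1) - P * ?f (e2 * e2 * p1) - Q * ?f (p2 * e2 * p1)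
      - R * ?f (p2 * p1 * p1 * p1) - S * ?f (e2 * p1 * p1 * p1)"
    unfolding expand lin A B E F H I by (simp add: algebra_simps)
  have cancel: "y / 563 ^ 2 * (563 ^ 2 * v) = y * v" "y / 563 * (563 * v) = y * v"
    "y / 563 ^ 2 * (- (563 ^ 2) * v) = - (y * v)" "y / 563 * (- 563 * v) = - (y * v)"
    for y v :: complex
    by simp_all
  show ?thesis
    unfolding sbase sE sF sG sH sI sJ sK sL sM sN sP sQ sR sS A5 t2 mult.assoc [of _ "5 ^ n"] cancel
      combination by simp
qed

end
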